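(* Let $\ell, m, n$ be nonnegative integers with $m+n\ge 1$, and let $a\in\mathbb{C}$ satisfy $\Re(a)>0$ and $|a|\geq 1$. Then $$\begin{aligned}(-1)^\ell \gamma_{\ell}(a)=\;& \sum_{j=2}^{\max(m,n)}\frac{(-m)_{j}-(-1)^{j}(-n)_{j}}{(-n-m)_{j}}\,\frac{(-1)^{j}}{j!}\sum_{k=0}^{\ell}s(j,k+1)\,\frac{\ell!}{(\ell-k)!}\,(-1)^{k}\,\zeta^{(\ell-k,0)}(j,a)\\ &+\sum_{k=0}^{\ell}\frac{\ell!}{(\ell-k)!}\,(\ln a)^{\ell-k}\sum_{j=1}^{m}\frac{(-m)_{j}}{(-n-m)_{j}}\,\frac{(-1)^{j+\ell+1}a^{-j}}{j!}\,s(j,k+1)\\ &+(-1)^{\ell+1}\frac{(\ln a)^{\ell+1}}{\ell+1}+R_{\ell,m,n,a},\end{aligned}$$ where $$R_{\ell,m,n,a}=\frac{(-1)^{m+1}}{(m+n)!}\sum_{k=0}^{\ell}s(m+n+1,k+1)\,\frac{\ell!}{(\ell-k)!}\,(-1)^{k}\int_{0}^{1}x^{m}(1-x)^{n}\,\zeta^{(\ell-k,0)}(m+n+1,a+x)\,dx.$$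
   Context: For $\Re(a)>0$, the Hurwitz zeta function is $\zeta(\sigma,a)=\sum_{k=0}^\infty (k+a)^{-\sigma}$ for $\Re(\sigma)>1$ (principal branch of the logarithm), analytically continued to $\sigma\in\mathbb{C}\setminus\{1\}$. The generalized Stieltjes constants $\gamma_\ell(a)$ are defined by the Laurent expansion at $\sigma=1$: $\zeta(\sigma,a)=\frac{1}{\sigma-1}+\sum_{\ell=0}^\infty \frac{(-1)^\ell}{\ell!}\gamma_\ell(a)(\sigma-1)^\ell$. $\zeta^{(r,0)}(j,a)$ denotes the $r$-th derivative of $\sigma\mapsto\zeta(\sigma,a)$ at $\sigma=j$ (for $r=0$ the value itself). $(x)_j=x(x+1)\cdots(x+j-1)$ is the Pochhammer symbol, $(x)_0=1$. $s(n,k)$ are the (signed) Stirling numbers of the first kind, defined by $(x)_n=\sum_{k=0}^n(-1)^{n-k}s(n,k)x^k$, with $s(n,k)=0$ for $k>n$. $\ln$ is the principal logarithm, $(\ln a)^0=1$ also when $a=1$, and empty sums are $0$. *)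

theory Defs
  imports "HOL-Complex_Analysis.Complex_Analysis" "HOL-Combinatorics.Stirling"
begin

(* For Re a > 0 the two conditions on f determine it on - {1}; its value at the pole 1
   is an arbitrary complex number. *)
definition hurwitz_zeta :: "complex \<Rightarrow> complex \<Rightarrow> complex" where
  "hurwitz_zeta s a =
     (SOME f. f holomorphic_on - {1} \<and>
        (\<forall>z. Re z > 1 \<longrightarrow> f z = (\<Sum>k. (of_nat k + a) powr (- z)))) s"

definition hurwitz_zeta_deriv :: "nat \<Rightarrow> complex \<Rightarrow> complex \<Rightarrow> complex" where
  "hurwitz_zeta_deriv r s a = (deriv ^^ r) (\<lambda>z. hurwitz_zeta z a) s"

(* The coefficient of (s - 1)^l in the Laurent expansion of the Hurwitz zeta function
   at s = 1 is (-1)^l / l! times the l-th generalized Stieltjes constant. *)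
definition stieltjes_gamma :: "nat \<Rightarrow> complex \<Rightarrow> complex" where
  "stieltjes_gamma l a =
     (-1) ^ l * fact l * fls_nth (laurent_expansion (\<lambda>s. hurwitz_zeta s a) 1) (int l)"

(* The library's stirling is unsigned; stirling n k = 0 for k > n. *)
definition signed_stirling :: "nat \<Rightarrow> nat \<Rightarrow> int" where
  "signed_stirling n k = (-1) ^ (n - k) * int (stirling n k)"

lemma pochhammer_signed_stirling:
  fixes x :: "'a :: comm_ring_1"
  shows "pochhammer x n = (\<Sum>k\<le>n. (-1) ^ (n - k) * of_int (signed_stirling n k) * x ^ k)"
  by (simp add: signed_stirling_def stirling_pochhammer mult.assoc[symmetric]
      flip: power_mult_distrib)

lemma signed_stirling_eq_0: "k > n \<Longrightarrow> signed_stirling n k = 0"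
  by (simp add: signed_stirling_def)

end

theory Submission
  imports Defs
begin

text \<open>
  With $N = m + n$, Darboux's formula for the kernel $x^m (1-x)^n$ and the function
  $t^{-w}$ expresses $(t+1)^{-w} - t^{-w}$ through higher derivatives at $t$ and $t+1$ and an
  integral of $x^m (1-x)^n (t+x)^{-w-N-1}$. Summing over $t = a, a+1, \dots$ telescopes the left
  side and turns everything else into values of the Hurwitz series, for $\mathrm{Re}\,w > 0$. Apart
  from the term with $\zeta(w+1,a)$, every series value in this identity is evaluated at least one
  unit further to the right. For $m = 0$ the identity therefore gives the analytic continuation,
  half-plane by half-plane; for general $m,n$ and $\mathrm{Re}\,w > -1$ it exhibits
  $\zeta(w+1,a) - a^{-w}/w$ as a combination of functions analytic at $w = 0$, and the theorem
  compares coefficients of $w^l$. The Stirling numbers are the coefficients of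
  $(w)_j/w = (w+1)_{j-1}$.
\<close>

subsection \<open>The Hurwitz series\<close>

text \<open>The bare series is kept apart from \<open>hurwitz_zeta\<close>: estimates, summation and
  integration take place for Re s > 1, and the two are identified only once a continuation is known
  to exist.\<close>

definition hurwitz_series :: "complex \<Rightarrow> complex \<Rightarrow> complex" where
  "hurwitz_series s b = (\<Sum>k. (of_nat k + b) powr (- s))"

text \<open>For z = k + b one has |z^(-s)| = |z|^(-Re s) exp(Im s Arg z); the first factor is
  controlled by |z| >= k, the second by |Arg z| <= pi. The bound does not involve \<open>b\<close>,
  which gives uniformity over the whole half-plane.\<close>

lemma norm_hurwitz_summand_le:
  fixes s b :: complex
  assumes "k \<ge> 1" "0 \<le> c" "c \<le> Re s" "norm s \<le> B" "Re b > 0"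
  shows "norm ((of_nat k + b) powr (- s)) \<le> exp (pi * B) * real k powr (- c)"
proof -
  have "real k \<le> Re (of_nat k + b)"
    using assms by simp
  also have "\<dots> \<le> norm (of_nat k + b)"
    by (rule complex_Re_le_cmod)
  finally have *: "real k \<le> norm (of_nat k + b)" .
  have "norm (of_nat k + b) powr (- Re s) \<le> real k powr (- Re s)"
    using assms * by (intro powr_mono2') auto
  also have "\<dots> \<le> real k powr (- c)"
    using assms by (intro powr_mono) auto
  finally have 1: "norm (of_nat k + b) powr (- Re s) \<le> real k powr (- c)" .
  have "Im s * Arg (of_nat k + b) \<le> \<bar>Im s\<bar> * \<bar>Arg (of_nat k + b)\<bar>"
    by (metis abs_ge_self abs_mult)
  also have "\<dots> \<le> B * pi"
    using assms abs_Im_le_cmod[of s] Arg_bounded[of "of_nat k + b"] by (intro mult_mono) auto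
  finally have 2: "exp (Im s * Arg (of_nat k + b)) \<le> exp (pi * B)"
    by (simp add: mult.commute)
  show ?thesis
    using mult_mono[OF 1 2] by (simp add: norm_powr_complex mult.commute)
qed

text \<open>Uniformity in both variables at once serves joint continuity, holomorphy in
  \<open>s\<close>, and termwise integration over shifts of \<open>a\<close>. The cap
  \<open>B\<close> on \<open>norm s\<close> is there for the factor
  \<open>exp (pi * B)\<close>.\<close>

lemma uniform_limit_hurwitz_series:
  assumes "1 < c"
  shows "uniform_limit ({s. c \<le> Re s \<and> norm s \<le> B} \<times> {b. Re b > 0})
    (\<lambda>K p. \<Sum>k<K. (of_nat k + snd p) powr (- fst p)) (\<lambda>p. hurwitz_series (fst p) (snd p)) sequentially"
  unfolding hurwitz_series_def
proof (rule Weierstrass_m_test_ev)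
  show "\<forall>\<^sub>F k in sequentially. \<forall>p\<in>{s. c \<le> Re s \<and> norm s \<le> B} \<times> {b. Re b > 0}.
          norm ((of_nat k + snd p) powr (- fst p)) \<le> exp (pi * B) * real k powr (- c)"
    \<comment> \<open>At \<open>k = 0\<close> the majorant is 0, so the bound is claimed from
      \<open>k = 1\<close> on.\<close>
    using eventually_ge_at_top[of 1]
    by eventually_elim (use assms norm_hurwitz_summand_le in auto)
  show "summable (\<lambda>k. exp (pi * B) * real k powr (- c))"
    using assms by (intro summable_mult) (simp add: summable_real_powr_iff)
qed

lemma hurwitz_series_sums:
  assumes "Re s > 1" "Re b > 0"
  shows "(\<lambda>k. (of_nat k + b) powr (- s)) sums hurwitz_series s b"
  using tendsto_uniform_limitI[OF uniform_limit_hurwitz_series[of "Re s" "norm s"], of "(s, b)"] assms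
  by (simp add: sums_def)

lemma continuous_on_hurwitz_series:
  "continuous_on ({s. Re s > 1} \<times> {b. Re b > 0}) (\<lambda>p. hurwitz_series (fst p) (snd p))"
proof -
  have "isCont (\<lambda>p. hurwitz_series (fst p) (snd p)) (s, b)" if "Re s > 1" "Re b > 0" for s b
  proof -
    define c where "c = (1 + Re s) / 2"
    define B where "B = norm s + 1"
    have c: "1 < c" "c < Re s"
      using that by (auto simp: c_def)
    \<comment> \<open>An open neighbourhood of the point on which the convergence is uniform, as
      \<open>c\<close> lies strictly between 1 and \<open>Re s\<close>.\<close>
    define A where "A = {s. c < Re s \<and> norm s < B} \<times> {b. Re b > 0}"
    have "continuous_on A (\<lambda>p. hurwitz_series (fst p) (snd p))"
    proof (rule uniform_limit_theorem)
      show "uniform_limit A (\<lambda>K p. \<Sum>k<K. (of_nat k + snd p) powr (- fst p))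
              (\<lambda>p. hurwitz_series (fst p) (snd p)) sequentially"
        using uniform_limit_hurwitz_series[OF c(1), of B]
        by (rule uniform_limit_on_subset) (auto simp: A_def)
      show "\<forall>\<^sub>F K in sequentially. continuous_on A (\<lambda>p. \<Sum>k<K. (of_nat k + snd p) powr (- fst p))"
        by (intro always_eventually allI continuous_intros)
           (auto simp: A_def complex_eq_iff add_nonneg_eq_0_iff intro!: add_nonneg_nonneg)
    qed auto
    moreover have "open A"
      unfolding A_def
      by (intro open_Times open_Collect_conj open_Collect_less continuous_intros)
    moreover have "(s, b) \<in> A"
      using c that by (simp add: A_def B_def)
    ultimately show ?thesis
      by (simp add: continuous_on_eq_continuous_at)
  qed
  thus ?thesis
    by (auto intro!: continuous_at_imp_continuous_on)
qed

lemma holomorphic_on_hurwitz_series: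
  assumes "Re b > 0"
  shows "(\<lambda>s. hurwitz_series s b) holomorphic_on {s. Re s > 1}"
proof (rule holomorphic_uniform_sequence)
  show "open {s. Re s > 1}"
    by (rule open_halfspace_Re_gt)
  show "(\<lambda>s. \<Sum>k<K. (of_nat k + b) powr (- s)) holomorphic_on {s. Re s > 1}" for K
    by (intro holomorphic_intros)
next
  fix s :: complex assume "s \<in> {s. Re s > 1}"
  \<comment> \<open>Half the distance to the line Re z = 1, so that the closed disc stays away from
    that line.\<close>
  define d where "d = (Re s - 1) / 2"
  have d: "d > 0" "Re s - d > 1"
    using \<open>s \<in> _\<close> by (auto simp: d_def field_simps)
  have sub: "Re s - d \<le> Re z \<and> norm z \<le> norm s + d" if "z \<in> cball s d" for z
  proof -
    have "norm (s - z) \<le> d"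
      using that by (simp add: dist_norm)
    moreover have "Re (s - z) \<le> norm (s - z)"
      by (rule complex_Re_le_cmod)
    moreover have "norm z - norm s \<le> norm (s - z)"
      by (metis norm_minus_commute norm_triangle_ineq2)
    ultimately show ?thesis
      by simp
  qed
  have "uniform_limit (cball s d) (\<lambda>K z. \<Sum>k<K. (of_nat k + b) powr (- z)) (\<lambda>z. hurwitz_series z b) sequentially"
    using uniform_limit_compose'[OF uniform_limit_hurwitz_series[OF d(2), of "norm s + d"],
        where h = "\<lambda>z. (z, b)" and B = "cball s d"]
      sub assms by (auto simp: o_def)
  moreover have "cball s d \<subseteq> {s. Re s > 1}"
    using sub d by force
  ultimately show "\<exists>d>0. cball s d \<subseteq> {s. Re s > 1} \<and>
      uniform_limit (cball s d) (\<lambda>K z. \<Sum>k<K. (of_nat k + b) powr (- z)) (\<lambda>z. hurwitz_series z b) sequentially"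
    using d by blast
qed

section \<open>Integrals depending holomorphically on a parameter\<close>

text \<open>Cauchy's formula on a circle, with the two integrations interchanged, gives both claims at once.\<close>

lemma parameter_integral_holomorphic:
  fixes F :: "complex \<Rightarrow> real \<Rightarrow> complex"
  assumes "open S"
    and cont: "continuous_on (S \<times> {0..1}) (\<lambda>p. F (fst p) (snd p))"
    and hol: "\<And>x. x \<in> {0..1} \<Longrightarrow> (\<lambda>w. F w x) holomorphic_on S"
  shows "(\<lambda>w. integral {0..1} (F w)) holomorphic_on S"
    and "z \<in> S \<Longrightarrow> (deriv ^^ r) (\<lambda>w. integral {0..1} (F w)) z =
           integral {0..1} (\<lambda>x. (deriv ^^ r) (\<lambda>w. F w x) z)"
proof -
  define I where "I = (\<lambda>w. integral {0..1} (F w))"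
  have contI: "continuous_on S I"
    using integral_continuous_on_param[of S 0 1 F] cont by (simp add: I_def case_prod_unfold)
  \<comment> \<open>Stated for a free point \<open>u\<close> and order \<open>r\<close>: with
    \<open>r = 0\<close> and moving \<open>u\<close> it yields differentiability of
    \<open>I\<close>; with \<open>u = z\<close> and arbitrary \<open>r\<close> it yields the
    derivative formula.\<close>
  have swap: "((\<lambda>w. I w / (w - u) ^ Suc r) has_contour_integral
         integral {0..1} (\<lambda>x. (2 * pi * \<i>) / fact r * (deriv ^^ r) (\<lambda>w. F w x) u)) (circlepath z e)"
    if "cball z e \<subseteq> S" "u \<in> ball z e" for z e u r
  proof -
    have "e > 0"
      using that(2) by (metis ball_eq_empty empty_iff not_le)
    have ne: "w \<noteq> u" if "w \<in> sphere z e" for w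
      using that \<open>u \<in> ball z e\<close> by auto
    have sub: "sphere z e \<subseteq> S"
      using that sphere_cball by blast
    \<comment> \<open>The interchange theorem concerns two contours in the plane, so the interval
      becomes the segment from 0 to 1 and \<open>F\<close> is evaluated at the real part.\<close>
    define G where "G = (\<lambda>w p. F w (Re p) / (w - u) ^ Suc r)"
    have path: "path_image (linepath 0 1) = of_real ` {0..1::real}"
      unfolding path_image_def linepath_def by (auto simp: scaleR_conv_of_real)
    have lp: "contour_integral (linepath 0 1) h = integral {0..1} (\<lambda>x. h (of_real x))" for h
      by (simp add: contour_integral_integral linepath_def scaleR_conv_of_real flip: of_real_diff of_real_add)
    have "continuous_on (sphere z e \<times> path_image (linepath 0 1)) (\<lambda>p. F (fst p) (Re (snd p)))"
      using sub by (intro continuous_on_compose2[OF cont, of _ "\<lambda>p. (fst p, Re (snd p))", simplified] continuous_intros)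
          (auto simp: path simp del: path_image_linepath)
    hence "continuous_on (path_image (circlepath z e) \<times> path_image (linepath 0 1)) (\<lambda>(y1, y2). G y1 y2)"
      using \<open>e > 0\<close> ne unfolding G_def case_prod_unfold by (intro continuous_intros) auto
    hence *: "contour_integral (circlepath z e) (\<lambda>w. contour_integral (linepath 0 1) (G w)) =
          contour_integral (linepath 0 1) (\<lambda>p. contour_integral (circlepath z e) (\<lambda>w. G w p))"
      by (rule contour_integral_swap)
         (auto simp: vector_derivative_circlepath vector_derivative_linepath_at intro!: continuous_intros)
    have cauchy: "contour_integral (circlepath z e) (\<lambda>w. G w (of_real x)) =
           (2 * pi * \<i>) / fact r * (deriv ^^ r) (\<lambda>w. F w x) u" if "x \<in> {0..1}" for x
      unfolding G_def Re_complex_of_real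
      using \<open>cball z e \<subseteq> S\<close> \<open>u \<in> ball z e\<close> hol[OF that] ball_subset_cball[of z e]
      by (intro contour_integral_unique Cauchy_has_contour_integral_higher_derivative_circlepath)
         (blast intro: holomorphic_on_subset holomorphic_on_imp_continuous_on)+
    have "(\<lambda>w. I w / (w - u) ^ Suc r) contour_integrable_on (circlepath z e)"
      using \<open>e > 0\<close> ne sub
      by (intro contour_integrable_continuous_circlepath continuous_intros
          continuous_on_subset[OF contI]) auto
    moreover have "contour_integral (circlepath z e) (\<lambda>w. I w / (w - u) ^ Suc r) =
        integral {0..1} (\<lambda>x. (2 * pi * \<i>) / fact r * (deriv ^^ r) (\<lambda>w. F w x) u)"
    proof -
      have "contour_integral (linepath 0 1) (G w) = I w / (w - u) ^ Suc r" for w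
        by (simp add: lp G_def I_def del: power_Suc)
      hence "contour_integral (circlepath z e) (\<lambda>w. I w / (w - u) ^ Suc r) =
          integral {0..1} (\<lambda>x. contour_integral (circlepath z e) (\<lambda>w. G w (of_real x)))"
        using * unfolding lp by simp
      also have "\<dots> = integral {0..1} (\<lambda>x. (2 * pi * \<i>) / fact r * (deriv ^^ r) (\<lambda>w. F w x) u)"
        by (intro integral_cong cauchy)
      finally show ?thesis .
    qed
    ultimately show ?thesis
      using has_contour_integral_integral by metis
  qed
  have holI: "I holomorphic_on S"
    unfolding holomorphic_on_open[OF \<open>open S\<close>]
  proof
    fix z assume "z \<in> S"
    then obtain e where e: "e > 0" "cball z e \<subseteq> S"
      using \<open>open S\<close> open_contains_cball by blast
    have "continuous_on (path_image (circlepath z e)) I"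
      using e by (intro continuous_on_subset[OF contI]) auto
    \<comment> \<open>A Cauchy integral of a merely continuous function is differentiable in
      \<open>u\<close>. By \<open>swap\<close> with order 0 this integral is 2 pi i times
      \<open>I\<close>, so \<open>I\<close> itself is differentiable.\<close>
    note D = Cauchy_next_derivative_circlepath(2)[OF this, of 1]
    define g where "g = (\<lambda>u. integral {0..1} (\<lambda>x. (2 * pi * \<i>) * F u x))"
    have "\<exists>f'. (g has_field_derivative f') (at z)"
      using D[of g z] swap[OF e(2), of _ 0] e(1) by (auto simp: g_def)
    then obtain f' where f': "(g has_field_derivative f') (at z)" ..
    moreover have "(\<lambda>u. g u / (2 * pi * \<i>)) = I"
      by (auto simp: fun_eq_iff g_def I_def)
    ultimately show "\<exists>f'. (I has_field_derivative f') (at z)"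
      using DERIV_cdivide[of g f' z UNIV "(2 * pi * \<i>)"] by auto
  qed
  thus "(\<lambda>w. integral {0..1} (F w)) holomorphic_on S"
    by (simp add: I_def)
  show "(deriv ^^ r) (\<lambda>w. integral {0..1} (F w)) z = integral {0..1} (\<lambda>x. (deriv ^^ r) (\<lambda>w. F w x) z)"
    if "z \<in> S"
  proof -
    from that obtain e where e: "e > 0" "cball z e \<subseteq> S"
      using \<open>open S\<close> open_contains_cball by blast
    have "((\<lambda>w. I w / (w - z) ^ Suc r) has_contour_integral
             (2 * pi * \<i>) / fact r * (deriv ^^ r) I z) (circlepath z e)"
      using e by (intro Cauchy_has_contour_integral_higher_derivative_circlepath
          continuous_on_subset[OF contI] holomorphic_on_subset[OF holI]) auto
    with swap[OF e(2), of z r] e(1)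
    have "(2 * pi * \<i>) / fact r * (deriv ^^ r) I z =
          (2 * pi * \<i>) / fact r * integral {0..1} (\<lambda>x. (deriv ^^ r) (\<lambda>w. F w x) z)"
      using has_contour_integral_unique by fastforce
    thus ?thesis
      by (simp add: I_def)
  qed
qed

subsection \<open>Darboux's formula\<close>

lemma pderiv_funpow_pcompose_reflect:
  fixes p :: "'a :: idom poly"
  shows "(pderiv ^^ i) (pcompose p [:1, - 1:]) = smult ((-1) ^ i) (pcompose ((pderiv ^^ i) p) [:1, - 1:])"
  by (induction i) (simp_all add: pderiv_pcompose pderiv_smult pderiv_pCons)

text \<open>The factor x^m shifts coefficients by m, leaving a binomial coefficient of (1 - x)^n;
  for j > n the index falls below m.\<close>

lemma coeff_beta_kernel:
  fixes m n j :: nat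
  assumes "j \<le> m + n"
  shows "coeff ([:0, 1:] ^ m * [:1, - 1:] ^ n :: 'a :: comm_ring_1 poly) (m + n - j) =
           (if j \<le> n then (-1) ^ (n - j) * of_nat (n choose j) else 0)"
proof -
  have "coeff ([:0, 1:] ^ m * [:1, - 1:] ^ n :: 'a poly) (m + n - j) =
          (if m + n - j < m then 0 else coeff ([:1, - 1:] ^ n :: 'a poly) (m + n - j - m))"
    by (simp add: coeff_monom_mult flip: monom_altdef[of 1, simplified])
  also have "\<dots> = (if j \<le> n then coeff ([:1, - 1:] ^ n :: 'a poly) (n - j) else 0)"
    using assms by auto
  also have "\<dots> = (if j \<le> n then (-1) ^ (n - j) * of_nat (n choose j) else 0)"
    by (auto simp: coeff_linear_poly_power binomial_symmetric[of j n] mult.commute)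
  finally show ?thesis .
qed

definition beta_kernel :: "nat \<Rightarrow> nat \<Rightarrow> complex poly" where
  "beta_kernel m n = [:0, 1:] ^ m * [:1, - 1:] ^ n"

lemma beta_kernel_reflect: "beta_kernel m n = pcompose (beta_kernel n m) [:1, - 1:]"
proof -
  have "pcompose (p ^ k) q = pcompose p q ^ k" for p q :: "complex poly" and k
    by (induction k) (simp_all add: pcompose_mult pcompose_1)
  thus ?thesis
    by (simp add: beta_kernel_def pcompose_mult pcompose_pCons mult.commute)
qed

lemma poly_pderiv_beta_kernel_0:
  assumes "j \<le> m + n"
  shows "poly ((pderiv ^^ (m + n - j)) (beta_kernel m n)) 0 =
           fact (m + n - j) * (if j \<le> n then (-1) ^ (n - j) * of_nat (n choose j) else 0)"
  unfolding beta_kernel_def using coeff_beta_kernel[OF assms, where 'a = complex]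
  by (simp add: poly_0_coeff_0 coeff_higher_pderiv pochhammer_fact)

text \<open>The reflection x -> 1 - x exchanges m and n and carries 1 to 0, at the price of one sign
  per derivative.\<close>

lemma poly_pderiv_beta_kernel_1:
  assumes "j \<le> m + n"
  shows "poly ((pderiv ^^ (m + n - j)) (beta_kernel m n)) 1 =
           fact (m + n - j) * (-1) ^ n * of_nat (m choose j)"
proof -
  have "poly ((pderiv ^^ (m + n - j)) (beta_kernel m n)) 1 =
          (-1) ^ (m + n - j) * poly ((pderiv ^^ (n + m - j)) (beta_kernel n m)) 0"
    by (subst beta_kernel_reflect) (simp add: pderiv_funpow_pcompose_reflect poly_pcompose add.commute)
  also have "\<dots> = fact (m + n - j) * ((-1) ^ (m + n - j) *
                 (if j \<le> m then (-1) ^ (m - j) * of_nat (m choose j) else 0))"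
    using assms by (subst poly_pderiv_beta_kernel_0) (auto simp: add.commute)
  \<comment> \<open>The exponents m + n - j and m - j add up to n modulo 2; for j > m the binomial
    coefficient vanishes.\<close>
  also have "(-1) ^ (m + n - j) * (if j \<le> m then (-1) ^ (m - j) * of_nat (m choose j) else 0) =
             ((-1) ^ n * of_nat (m choose j) :: complex)"
  proof (cases "j \<le> m")
    case True
    hence "(-1 :: complex) ^ (m + n - j) = (-1) ^ n * (-1) ^ (m - j)"
      by (simp add: add.commute flip: power_add)
    moreover have "(-1 :: complex) ^ (m - j) * ((-1) ^ (m - j) * c) = c" for c
      by (simp flip: mult.assoc power_mult_distrib)
    ultimately show ?thesis
      using True by (simp add: mult.assoc)
  qed auto
  finally show ?thesis by simp
qed

text \<open>The alternating sum, evaluated at a variable point, has a telescoping derivative.\<close>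

lemma darboux_formula:
  fixes f :: "nat \<Rightarrow> complex \<Rightarrow> complex" and p :: "complex poly"
  assumes f: "\<And>j x. x \<in> closed_segment 0 1 \<Longrightarrow> (f j has_field_derivative f (Suc j) x) (at x)"
    and "degree p \<le> N"
  shows "((\<lambda>x. (-1) ^ N * poly p (of_real x) * f (Suc N) (of_real x)) has_integral
           (\<Sum>j\<le>N. (-1) ^ j * (poly ((pderiv ^^ (N - j)) p) 1 * f j 1
                               - poly ((pderiv ^^ (N - j)) p) 0 * f j 0))) {0..1}"
proof -
  define P where "P = (\<lambda>i x. poly ((pderiv ^^ i) p) x)"
  define W where "W = (\<lambda>K x. \<Sum>j\<le>K. (-1) ^ j * (P (N - j) x * f j x))"
  have P_Suc: "(P i has_field_derivative P (Suc i) x) (at x)" for i x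
    by (simp add: P_def poly_DERIV)
  \<comment> \<open>By the degree bound the N-th derivative of \<open>p\<close> is constant. This
    starts the telescoping: the derivative of the first product has a single term.\<close>
  have "degree ((pderiv ^^ i) p) \<le> N - i" for i
    using assms(2) by (induction i) (auto simp: degree_pderiv)
  hence "degree ((pderiv ^^ N) p) = 0"
    by (metis diff_self_eq_0 le_zero_eq)
  hence PN: "P (Suc N) x = 0" for x
    using pderiv_eq_0_iff[of "(pderiv ^^ N) p"] by (simp add: P_def)
  have W: "(W K has_field_derivative (-1) ^ K * (P (N - K) x * f (Suc K) x)) (at x)"
    if "K \<le> N" "x \<in> closed_segment 0 1" for K x
    using that(1)
  proof (induction K)
    case 0
    have "((\<lambda>x. P N x * f 0 x) has_field_derivative P (Suc N) x * f 0 x + P N x * f (Suc 0) x) (at x)"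
      by (rule derivative_eq_intros P_Suc f that refl)+ (simp add: mult.commute)
    thus ?case by (simp add: W_def PN)
  next
    case (Suc K)
    have "((\<lambda>x. W K x + (-1) ^ Suc K * (P (N - Suc K) x * f (Suc K) x)) has_field_derivative
            (-1) ^ K * (P (N - K) x * f (Suc K) x) +
            (-1) ^ Suc K * (P (Suc (N - Suc K)) x * f (Suc K) x + f (Suc (Suc K)) x * P (N - Suc K) x)) (at x)"
      using Suc by (intro DERIV_add DERIV_cmult DERIV_mult P_Suc f that) simp_all
    moreover have "Suc (N - Suc K) = N - K"
      using Suc.prems by simp
    ultimately show ?case
      by (simp add: W_def algebra_simps)
  qed
  have "((\<lambda>x. (-1) ^ N * (P 0 (of_real x) * f (Suc N) (of_real x))) has_integral
          (W N (of_real 1) - W N (of_real 0))) {0..1}"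
  proof (rule fundamental_theorem_of_calculus)
    fix x :: real assume "x \<in> {0..1}"
    hence "of_real x \<in> closed_segment (0 :: complex) 1"
      by (auto simp: closed_segment_def scaleR_conv_of_real)
    from W[OF order_refl this] show "((\<lambda>x. W N (of_real x)) has_vector_derivative
        (-1) ^ N * (P 0 (of_real x) * f (Suc N) (of_real x))) (at x within {0..1})"
      by (auto intro!: has_vector_derivative_real_field)
  qed auto
  thus ?thesis
    by (simp add: W_def P_def algebra_simps sum_subtractf)
qed

subsection \<open>Summation of the Darboux formula\<close>

text \<open>
  Up to the common factor $(-1)^n (m+n)!$, the $(m+n-j)$-th derivative of the kernel is
  \<open>darboux_coeff m n j\<close> at $1$ and \<open>(-1) ^ j * darboux_coeff n m j\<close> at $0$.
\<close>

definition darboux_coeff :: "nat \<Rightarrow> nat \<Rightarrow> nat \<Rightarrow> complex" where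
  "darboux_coeff m n j = pochhammer (- of_nat m) j / pochhammer (- of_nat n - of_nat m) j / fact j"

text \<open>Pochhammer symbols at negative integers are binomial coefficients up to (-1)^j j!. The
  quotient is what the kernel derivatives of order m + n - j yield after division by (m +
  n)!.\<close>

lemma darboux_coeff_eq:
  assumes "j \<le> m + n"
  shows "darboux_coeff m n j = fact (m + n - j) * of_nat (m choose j) / fact (m + n)"
proof -
  have *: "pochhammer (- of_nat k) j = (-1) ^ j * fact j * (of_nat (k choose j) :: complex)" for k
    by (simp add: binomial_gbinomial gbinomial_pochhammer flip: power_mult_distrib mult.assoc)
  have "(- of_nat n - of_nat m :: complex) = - of_nat (m + n)"
    by simp
  hence "pochhammer (- of_nat n - of_nat m) j = (-1) ^ j * fact j * (of_nat ((m + n) choose j) :: complex)"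
    using *[of "m + n"] by metis
  moreover have "of_nat ((m + n) choose j) = (fact (m + n) / (fact j * fact (m + n - j)) :: complex)"
    using assms by (rule binomial_fact)
  ultimately have "pochhammer (- of_nat n - of_nat m) j = ((-1) ^ j * fact (m + n) / fact (m + n - j) :: complex)"
    by simp
  thus ?thesis
    by (simp add: darboux_coeff_def *)
qed

lemma darboux_coeff_0 [simp]: "darboux_coeff m n 0 = 1"
  by (simp add: darboux_coeff_def)

text \<open>Once j > m, the product (-m)_j contains the factor 0. This is what cuts sums over j <= m
  + n down to j <= max(m, n) or j <= m.\<close>

lemma darboux_coeff_eq_0: "m < j \<Longrightarrow> darboux_coeff m n j = 0"
  by (simp add: darboux_coeff_def pochhammer_of_nat_eq_0_iff)

text \<open>The two values are m/(m+n) and n/(m+n). Their sum is the coefficient of the series at w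
  + 1 in the recurrence, which can therefore be solved for it.\<close>

lemma darboux_coeff_1:
  assumes "m + n \<ge> 1"
  shows "darboux_coeff m n 1 + darboux_coeff n m 1 = 1"
proof -
  obtain k where k: "m + n = Suc k"
    using assms by (metis One_nat_def Suc_le_D)
  have "darboux_coeff m n 1 + darboux_coeff n m 1 =
          fact (m + n - 1) * of_nat (m + n) / fact (m + n)"
    using assms by (simp add: darboux_coeff_eq add.commute[of n m] add_divide_distrib distrib_left)
  also have "\<dots> = 1"
    unfolding k by (simp add: divide_simps del: of_nat_Suc)
  finally show ?thesis .
qed

text \<open>Darboux's formula for powers of t + x, divided by (-1)^n (m + n)!. The term j = 0 is the
  difference (t + 1)^(-w) - t^(-w) that telescopes later.\<close>

lemma darboux_powr:
  fixes t w :: complex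
  assumes "Re t > 0"
  shows "(\<Sum>j\<le>m + n. pochhammer w j * (darboux_coeff m n j * (t + 1) powr (- (w + of_nat j))
            - (-1) ^ j * darboux_coeff n m j * t powr (- (w + of_nat j)))) =
         - ((-1) ^ n / fact (m + n) * pochhammer w (m + n + 1) *
         integral {0..1} (\<lambda>x. of_real (x ^ m * (1 - x) ^ n) * (t + of_real x) powr (- (w + of_nat (m + n + 1)))))"
    (is "?S = - (_ * _ * integral _ ?g)")
proof -
  define N where "N = m + n"
  \<comment> \<open>The j-th derivative of (t + x)^(-w) with respect to \<open>x\<close>; for Re t >
    0 the segment from t to t + 1 avoids the branch cut.\<close>
  define f where "f = (\<lambda>j x. (-1) ^ j * pochhammer w j * (t + x) powr (- (w + of_nat j)))"
  have deriv: "(f j has_field_derivative f (Suc j) x) (at x)" if "x \<in> closed_segment 0 1" for j x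
  proof -
    have "t + x \<notin> \<real>\<^sub>\<le>\<^sub>0"
      using that assms by (auto simp: closed_segment_def complex_nonpos_Reals_iff)
    hence "(f j has_field_derivative (-1) ^ j * pochhammer w j *
             ((- (w + of_nat j)) * (t + x) powr (- (w + of_nat j) - 1))) (at x)"
      unfolding f_def by (auto intro!: derivative_eq_intros)
    also have "(-1) ^ j * pochhammer w j * ((- (w + of_nat j)) * (t + x) powr (- (w + of_nat j) - 1)) =
               f (Suc j) x"
      by (simp add: f_def pochhammer_Suc algebra_simps)
    finally show ?thesis .
  qed
  have "degree ([:0, 1 :: complex:] ^ m) \<le> m" "degree ([:1, - 1 :: complex:] ^ n) \<le> n"
    using degree_power_le[of "[:0, 1 :: complex:]" m] degree_power_le[of "[:1, - 1 :: complex:]" n] by simp_all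
  hence deg: "degree (beta_kernel m n) \<le> N"
    using degree_mult_le[of "[:0, 1 :: complex:] ^ m" "[:1, - 1 :: complex:] ^ n"]
    by (simp add: beta_kernel_def N_def)
  have "((\<lambda>x. (-1) ^ N * poly (beta_kernel m n) (of_real x) * f (Suc N) (of_real x)) has_integral
           (\<Sum>j\<le>N. (-1) ^ j * (poly ((pderiv ^^ (N - j)) (beta_kernel m n)) 1 * f j 1
                               - poly ((pderiv ^^ (N - j)) (beta_kernel m n)) 0 * f j 0))) {0..1}"
    by (rule darboux_formula[of f, OF deriv deg])
  also have "(\<lambda>x. (-1) ^ N * poly (beta_kernel m n) (of_real x) * f (Suc N) (of_real x)) =
             (\<lambda>x. - pochhammer w (N + 1) * ?g x)"
  proof
    fix x :: real
    have "(-1 :: complex) ^ N * c * ((-1) ^ Suc N * d * e) = - d * (c * e)" for c d e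
      by (simp add: mult_ac flip: power_mult_distrib)
    thus "(-1) ^ N * poly (beta_kernel m n) (of_real x) * f (Suc N) (of_real x) = - pochhammer w (N + 1) * ?g x"
      by (simp add: f_def beta_kernel_def N_def del: power_Suc pochhammer_Suc of_nat_Suc)
  qed
  also have "(\<Sum>j\<le>N. (-1) ^ j * (poly ((pderiv ^^ (N - j)) (beta_kernel m n)) 1 * f j 1
                               - poly ((pderiv ^^ (N - j)) (beta_kernel m n)) 0 * f j 0)) =
             (-1) ^ n * fact N * ?S"
    unfolding sum_distrib_left N_def
  proof (intro sum.cong refl)
    fix j assume "j \<in> {..m + n}"
    hence j: "j \<le> m + n" "j \<le> n + m" by auto
    have 1: "poly ((pderiv ^^ (m + n - j)) (beta_kernel m n)) 1 = (-1) ^ n * fact (m + n) * darboux_coeff m n j"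
      using j by (simp add: poly_pderiv_beta_kernel_1 darboux_coeff_eq)
    have 0: "poly ((pderiv ^^ (m + n - j)) (beta_kernel m n)) 0 =
               (-1) ^ n * fact (m + n) * ((-1) ^ j * darboux_coeff n m j)"
    proof (cases "j \<le> n")
      case True
      hence "(-1 :: complex) ^ n = (-1) ^ (n - j) * (-1) ^ j"
        by (simp flip: power_add)
      thus ?thesis
        using j True by (simp add: poly_pderiv_beta_kernel_0 darboux_coeff_eq add.commute
            flip: power_mult_distrib)
    next
      case False
      thus ?thesis
        using j by (simp add: poly_pderiv_beta_kernel_0 darboux_coeff_eq)
    qed
    have "(-1 :: complex) ^ j * ((-1) ^ j * z) = z" for z
      by (simp flip: mult.assoc power_mult_distrib)
    thus "(-1) ^ j * (poly ((pderiv ^^ (m + n - j)) (beta_kernel m n)) 1 * f j 1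
             - poly ((pderiv ^^ (m + n - j)) (beta_kernel m n)) 0 * f j 0) =
          (-1) ^ n * fact (m + n) *
            (pochhammer w j * (darboux_coeff m n j * (t + 1) powr (- (w + of_nat j))
             - (-1) ^ j * darboux_coeff n m j * t powr (- (w + of_nat j))))"
      unfolding 0 1 f_def by (simp add: algebra_simps)
  qed
  finally have "integral {0..1} (\<lambda>x. - pochhammer w (N + 1) * ?g x) = (-1) ^ n * fact N * ?S"
    by (rule integral_unique)
  hence "(-1) ^ n * fact N * ?S = - pochhammer w (N + 1) * integral {0..1} ?g"
    by simp
  hence "(-1) ^ n * ((-1) ^ n * (fact N * ?S)) = (-1) ^ n * (- pochhammer w (N + 1) * integral {0..1} ?g)"
    by (simp only: mult.assoc)
  hence "fact N * ?S = - ((-1) ^ n * pochhammer w (N + 1) * integral {0..1} ?g)"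
    by (simp flip: mult.assoc power_mult_distrib)
  moreover have "fact N * s = y \<Longrightarrow> s = y / fact N" for s y :: complex
    by (simp add: divide_simps mult.commute)
  ultimately have "?S = - ((-1) ^ n * pochhammer w (N + 1) * integral {0..1} ?g) / fact N"
    by blast
  thus ?thesis
    by (simp add: N_def)
qed

section \<open>Integrals of the Hurwitz series against the kernel\<close>

definition beta_hurwitz :: "nat \<Rightarrow> nat \<Rightarrow> complex \<Rightarrow> complex \<Rightarrow> complex" where
  "beta_hurwitz m n a s =
     integral {0..1} (\<lambda>x. of_real (x ^ m * (1 - x) ^ n) * hurwitz_series s (a + of_real x))"

text \<open>An instance of \<open>parameter_integral_holomorphic\<close>. Differentiating under the
  integral produces the derivatives of the Hurwitz zeta function that appear in the
  remainder.\<close>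

lemma beta_hurwitz_holomorphic:
  assumes "Re a > 0"
  shows "beta_hurwitz m n a holomorphic_on {s. Re s > 1}"
    and "Re s > 1 \<Longrightarrow> (deriv ^^ r) (beta_hurwitz m n a) s = integral {0..1} (\<lambda>x. of_real (x ^ m * (1 - x) ^ n) *
            (deriv ^^ r) (\<lambda>s. hurwitz_series s (a + of_real x)) s)"
proof -
  define F where "F = (\<lambda>s x. of_real (x ^ m * (1 - x) ^ n) * hurwitz_series s (a + of_real x))"
  have *: "beta_hurwitz m n a = (\<lambda>s. integral {0..1} (F s))"
    by (simp add: fun_eq_iff beta_hurwitz_def F_def)
  have "continuous_on ({s. Re s > 1} \<times> {0..1})
          (\<lambda>p. hurwitz_series (fst p) (a + of_real (snd p)))"
    using assms
    by (intro continuous_on_compose2[OF continuous_on_hurwitz_series,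
          of _ "\<lambda>p. (fst p, a + of_real (snd p))", simplified] continuous_intros) auto
  hence cont: "continuous_on ({s. Re s > 1} \<times> {0..1}) (\<lambda>p. F (fst p) (snd p))"
    unfolding F_def by (intro continuous_intros)
  have hol: "(\<lambda>s. hurwitz_series s (a + of_real x)) holomorphic_on {s. Re s > 1}" if "x \<in> {0..1}" for x
    using that assms by (intro holomorphic_on_hurwitz_series) auto
  hence holF: "(\<lambda>s. F s x) holomorphic_on {s. Re s > 1}" if "x \<in> {0..1}" for x
    using that unfolding F_def by (intro holomorphic_intros)
  note D = parameter_integral_holomorphic[OF open_halfspace_Re_gt cont holF, simplified]
  show "beta_hurwitz m n a holomorphic_on {s. Re s > 1}"
    unfolding * by (rule D(1))
  show "(deriv ^^ r) (beta_hurwitz m n a) s = integral {0..1} (\<lambda>x. of_real (x ^ m * (1 - x) ^ n) *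
          (deriv ^^ r) (\<lambda>s. hurwitz_series s (a + of_real x)) s)" if "Re s > 1"
  proof -
    have "(deriv ^^ r) (\<lambda>s. F s x) s = of_real (x ^ m * (1 - x) ^ n) *
            (deriv ^^ r) (\<lambda>s. hurwitz_series s (a + of_real x)) s" if "x \<in> {0..1}" for x
      unfolding F_def using hol[OF that] \<open>Re s > 1\<close>
      by (intro higher_deriv_cmult[OF _ _ open_halfspace_Re_gt]) auto
    thus ?thesis
      unfolding * D(2)[OF that] by (intro integral_cong)
  qed
qed

text \<open>The series converges uniformly in \<open>x\<close>, also after multiplication by the
  bounded kernel, so sum and integral commute.\<close>

lemma beta_hurwitz_sums:
  assumes "Re a > 0" "Re s > 1"
  shows "(\<lambda>k. integral {0..1} (\<lambda>x. of_real (x ^ m * (1 - x) ^ n) * (of_nat k + a + of_real x) powr (- s)))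
           sums beta_hurwitz m n a s"
proof -
  define \<phi> where "\<phi> = (\<lambda>x. of_real (x ^ m * (1 - x) ^ n) :: complex)"
  define g where "g = (\<lambda>K x. \<Sum>k<K. (of_nat k + (a + of_real x)) powr (- s))"
  have g_cont: "continuous_on {0..1} (g K)" for K
    unfolding g_def using assms
    by (intro continuous_intros) (auto simp: complex_eq_iff intro!: add_nonneg_nonneg)
  have \<phi>_cont: "continuous_on {0..1} \<phi>"
    unfolding \<phi>_def by (intro continuous_intros)
  have h_cont: "continuous_on {0..1::real} (\<lambda>x. hurwitz_series s (a + of_real x))"
    using assms
    by (intro continuous_on_compose2[OF continuous_on_hurwitz_series,
          of _ "\<lambda>x. (s, a + of_real x)", simplified] continuous_intros) auto
  have "uniform_limit {0..1} g (\<lambda>x. hurwitz_series s (a + of_real x)) sequentially"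
    unfolding g_def
    using uniform_limit_compose'[OF uniform_limit_hurwitz_series[OF assms(2), of "norm s"],
        where h = "\<lambda>x. (s, a + of_real x)" and B = "{0..1}"] assms by auto
  hence "uniform_limit {0..1} (\<lambda>K x. \<phi> x * g K x) (\<lambda>x. \<phi> x * hurwitz_series s (a + of_real x)) sequentially"
    by (intro uniform_lim_mult uniform_limit_const compact_imp_bounded compact_continuous_image
        \<phi>_cont h_cont) auto
  then obtain I J where IJ: "\<And>K. ((\<lambda>x. \<phi> x * g K x) has_integral I K) {0..1}"
      "((\<lambda>x. \<phi> x * hurwitz_series s (a + of_real x)) has_integral J) {0..1}" "I \<longlonglongrightarrow> J"
    by (rule uniform_limit_integral) (auto intro: continuous_on_mult[OF \<phi>_cont g_cont])
  have J: "J = beta_hurwitz m n a s"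
    using IJ(2) by (auto simp: beta_hurwitz_def \<phi>_def dest: integral_unique)
  have I: "I K = (\<Sum>k<K. integral {0..1} (\<lambda>x. \<phi> x * (of_nat k + a + of_real x) powr (- s)))" for K
  proof -
    have "I K = integral {0..1} (\<lambda>x. \<phi> x * g K x)"
      using IJ(1)[of K] by (simp add: integral_unique)
    also have "\<dots> = integral {0..1} (\<lambda>x. \<Sum>k<K. \<phi> x * (of_nat k + a + of_real x) powr (- s))"
      by (simp add: g_def sum_distrib_left add.assoc)
    also have "\<dots> = (\<Sum>k<K. integral {0..1} (\<lambda>x. \<phi> x * (of_nat k + a + of_real x) powr (- s)))"
    proof (rule integral_sum)
      show "(\<lambda>x. \<phi> x * (of_nat k + a + of_real x) powr (- s)) integrable_on {0..1}" for k
        using assms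
        by (intro integrable_continuous_interval continuous_intros \<phi>_cont)
           (auto simp: complex_eq_iff intro!: add_nonneg_nonneg)
    qed auto
    finally show ?thesis .
  qed
  have "(\<lambda>K. \<Sum>k<K. integral {0..1} (\<lambda>x. \<phi> x * (of_nat k + a + of_real x) powr (- s)))
          \<longlonglongrightarrow> beta_hurwitz m n a s"
    using IJ(3) unfolding J I[abs_def] .
  thus ?thesis
    unfolding sums_def \<phi>_def .
qed

text \<open>\<open>darboux_powr\<close> is summed over t = a + k. The terms with j >= 1 converge
  separately because Re (w + j) > 1, and the shift from t to t + 1 costs the first summand
  a^(-w-j).\<close>

lemma hurwitz_series_recurrence:
  assumes "Re a > 0" "Re w > 0"
  shows "a powr (- w) =
     (\<Sum>j=1..m + n. pochhammer w j *
        ((darboux_coeff m n j - (-1) ^ j * darboux_coeff n m j) * hurwitz_series (w + of_nat j) a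
         - darboux_coeff m n j * a powr (- (w + of_nat j))))
     + (-1) ^ n / fact (m + n) * pochhammer w (m + n + 1) * beta_hurwitz m n a (w + of_nat (m + n + 1))"
proof -
  define p where "p = (\<lambda>s k. (of_nat k + a) powr (- s))"
  define d where "d = (\<lambda>j. (-1) ^ j * darboux_coeff n m j)"
  define T where "T = (\<lambda>j k. pochhammer w j * (darboux_coeff m n j * p (w + of_nat j) (Suc k)
                                - d j * p (w + of_nat j) k))"
  define L where "L = (\<lambda>j. pochhammer w j *
     ((darboux_coeff m n j - d j) * hurwitz_series (w + of_nat j) a
         - darboux_coeff m n j * a powr (- (w + of_nat j))))"
  have "(\<lambda>k. exp (pi * norm w) * real k powr (- Re w)) \<longlonglongrightarrow> exp (pi * norm w) * 0"
    using assms by (intro tendsto_intros tendsto_neg_powr filterlim_real_sequentially) auto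
  hence "(\<lambda>k. exp (pi * norm w) * real k powr (- Re w)) \<longlonglongrightarrow> 0"
    by simp
  hence "p w \<longlonglongrightarrow> 0"
    unfolding p_def
    by (rule Lim_null_comparison[rotated])
       (use assms in \<open>auto intro!: eventually_sequentiallyI[of 1] norm_hurwitz_summand_le\<close>)
  \<comment> \<open>Both coefficients are 1 at j = 0, so \<open>T 0\<close> consists of consecutive
    differences of \<open>p w\<close>, which tends to 0 because Re w > 0.\<close>
  from telescope_sums[OF this] have T0: "T 0 sums (- (a powr (- w)))"
    by (simp add: T_def d_def p_def)
  have TL: "T j sums L j" if "j \<ge> 1" for j
  proof -
    have "Re (w + of_nat j) > 1"
      using that assms by simp
    hence *: "p (w + of_nat j) sums hurwitz_series (w + of_nat j) a"
      unfolding p_def using assms by (intro hurwitz_series_sums)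
    hence "(\<lambda>k. p (w + of_nat j) (Suc k)) sums (hurwitz_series (w + of_nat j) a - p (w + of_nat j) 0)"
      by (subst sums_Suc_iff) simp
    hence "T j sums (pochhammer w j *
        (darboux_coeff m n j * (hurwitz_series (w + of_nat j) a - p (w + of_nat j) 0)
           - d j * hurwitz_series (w + of_nat j) a))"
      unfolding T_def using * by (intro sums_mult sums_diff)
    thus ?thesis
      by (simp add: L_def p_def algebra_simps)
  qed
  have "(\<lambda>k. T 0 k + (\<Sum>j=1..m + n. T j k)) sums (- (a powr (- w)) + (\<Sum>j=1..m + n. L j))"
    by (intro sums_add T0 sums_sum TL) auto
  also have "(\<lambda>k. T 0 k + (\<Sum>j=1..m + n. T j k)) = (\<lambda>k. - ((-1) ^ n / fact (m + n) * pochhammer w (m + n + 1) *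
     integral {0..1} (\<lambda>x. of_real (x ^ m * (1 - x) ^ n) *
         (of_nat k + a + of_real x) powr (- (w + of_nat (m + n + 1))))))" (is "_ = ?R")
  proof
    fix k
    have "T 0 k + (\<Sum>j=1..m + n. T j k) = (\<Sum>j\<le>m + n. T j k)"
      by (simp add: atMost_atLeast0 sum.atLeast_Suc_atMost)
    also have "\<dots> = ?R k"
      using darboux_powr[where t = "of_nat k + a" and m = m and n = n and w = w] assms
      by (simp add: T_def d_def p_def add_ac)
    finally show "T 0 k + (\<Sum>j=1..m + n. T j k) = ?R k" .
  qed
  finally have "?R sums (- (a powr (- w)) + (\<Sum>j=1..m + n. L j))" .
  moreover have "?R sums (- ((-1) ^ n / fact (m + n) * pochhammer w (m + n + 1) *
                    beta_hurwitz m n a (w + of_nat (m + n + 1))))"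
    using assms by (intro sums_minus sums_mult beta_hurwitz_sums) auto
  ultimately have "- (a powr (- w)) + (\<Sum>j=1..m + n. L j) =
      - ((-1) ^ n / fact (m + n) * pochhammer w (m + n + 1) * beta_hurwitz m n a (w + of_nat (m + n + 1)))"
    by (rule sums_unique2)
  hence "a powr (- w) = (\<Sum>j=1..m + n. L j) +
      (-1) ^ n / fact (m + n) * pochhammer w (m + n + 1) * beta_hurwitz m n a (w + of_nat (m + n + 1))"
    by (simp add: algebra_simps)
  thus ?thesis
    by (simp only: L_def d_def)
qed

subsection \<open>Analytic continuation\<close>

text \<open>The property under the choice operator in \<open>hurwitz_zeta\<close>; a single witness
  makes the chosen function satisfy it.\<close>

definition hurwitz_spec :: "complex \<Rightarrow> (complex \<Rightarrow> complex) \<Rightarrow> bool" where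
  "hurwitz_spec a f \<longleftrightarrow> f holomorphic_on - {1} \<and> (\<forall>z. Re z > 1 \<longrightarrow> f z = hurwitz_series z a)"

lemma halfplane_identity:
  fixes f g :: "complex \<Rightarrow> complex"
  assumes "f holomorphic_on {w. Re w > c}" "g holomorphic_on {w. Re w > c}"
    and "\<And>w. Re w > d \<Longrightarrow> f w = g w" and "Re w > c"
  shows "f w = g w"
proof -
  define U where "U = {w. Re w > max c d}"
  \<comment> \<open>A real point to the right of both bounds, serving as the limit point for the
    identity theorem.\<close>
  define \<xi> :: complex where "\<xi> = of_real (max c d + 1)"
  have "\<xi> \<in> U"
    unfolding U_def \<xi>_def mem_Collect_eq Re_complex_of_real by linarith
  moreover have "open U"
    unfolding U_def by (rule open_halfspace_Re_gt)
  ultimately have "\<xi> islimpt U"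
    by (simp add: interior_limit_point interior_open)
  hence "f w - g w = 0"
    by (rule analytic_continuation[OF holomorphic_on_diff[OF assms(1,2)] open_halfspace_Re_gt
          convex_connected[OF convex_halfspace_Re_gt], rotated 2])
       (use assms(3,4) \<open>\<xi> \<in> U\<close> in \<open>auto simp: U_def\<close>)
  thus ?thesis by simp
qed

text \<open>
  Multiplying by $w$ removes the pole; $(w)_j\,\zeta(w+j,a) = (w)_{j-1} Z(w+j-1)$ then makes the
  recurrence one for the entire function $Z(w) = w\,\zeta(w+1,a)$.
\<close>

lemma hurwitz_series_continuation_halfplane:
  assumes "Re a > 0"
  shows "\<exists>Z. Z holomorphic_on {w. Re w > - real N} \<and>
           (\<forall>w. Re w > 0 \<longrightarrow> Z w = w * hurwitz_series (w + 1) a)"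
proof (induction N)
  case 0
  have "(\<lambda>w. hurwitz_series (w + 1) a) holomorphic_on {w. Re w > 0}"
    by (rule holomorphic_on_compose_gen[OF _ holomorphic_on_hurwitz_series[OF assms],
          of "\<lambda>w. w + 1", unfolded o_def]) (auto intro!: holomorphic_intros)
  thus ?case
    by (intro exI[of _ "\<lambda>w. w * hurwitz_series (w + 1) a"]) (auto intro!: holomorphic_intros)
next
  case (Suc N)
  then obtain Z where Z: "Z holomorphic_on {w. Re w > - real N}"
    "\<And>w. Re w > 0 \<Longrightarrow> Z w = w * hurwitz_series (w + 1) a" by blast
  \<comment> \<open>With m = 0 the values \<open>darboux_coeff 0 M j\<close> vanish for j >= 1,
    which removes the boundary powers of \<open>a\<close>. With n = N + 1 the remainder is evaluated
    at w + N + 2, of real part > 1 when Re w > -(N + 1).\<close>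
  define M where "M = Suc N"
  define c where "c = (\<lambda>j. darboux_coeff 0 M j - (-1) ^ j * darboux_coeff M 0 j)"
  define Z' where "Z' = (\<lambda>w. a powr (- w)
     - (\<Sum>j=2..M. c j * pochhammer w (j - 1) * Z (w + of_nat (j - 1)))
     - (-1) ^ M / fact M * pochhammer w (M + 1) * beta_hurwitz 0 M a (w + of_nat (M + 1)))"
  have "Z' w = w * hurwitz_series (w + 1) a" if "Re w > 0" for w
  proof -
    have c1: "c 1 = 1"
      using darboux_coeff_1[of 0 M] by (simp add: c_def M_def)
    have "a powr (- w) = (\<Sum>j=1..M. pochhammer w j * (c j * hurwitz_series (w + of_nat j) a))
       + (-1) ^ M / fact M * pochhammer w (M + 1) * beta_hurwitz 0 M a (w + of_nat (M + 1))"
      using hurwitz_series_recurrence[OF assms that, of 0 M] by (simp add: c_def darboux_coeff_eq_0)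
    also have "(\<Sum>j=1..M. pochhammer w j * (c j * hurwitz_series (w + of_nat j) a)) =
        w * hurwitz_series (w + 1) a + (\<Sum>j=2..M. pochhammer w j * (c j * hurwitz_series (w + of_nat j) a))"
      using c1 by (subst sum.atLeast_Suc_atMost) (auto simp: M_def numeral_2_eq_2)
    also have "(\<Sum>j=2..M. pochhammer w j * (c j * hurwitz_series (w + of_nat j) a)) =
        (\<Sum>j=2..M. c j * pochhammer w (j - 1) * Z (w + of_nat (j - 1)))"
    proof (intro sum.cong refl)
      fix j assume "j \<in> {2..M}"
      then obtain i where i: "j = Suc i" "i \<ge> 1"
        by (cases j) auto
      thus "pochhammer w j * (c j * hurwitz_series (w + of_nat j) a) =
            c j * pochhammer w (j - 1) * Z (w + of_nat (j - 1))"
        using that by (simp add: Z(2) pochhammer_Suc add_ac)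
    qed
    finally show ?thesis
      by (simp add: Z'_def)
  qed
  moreover have "Z' holomorphic_on {w. Re w > - real (Suc N)}"
  proof -
    \<comment> \<open>The shift j - 1 is at least 1, so the argument lies in the half-plane where
      \<open>Z\<close> is already known.\<close>
    have "(\<lambda>w. Z (w + of_nat (j - 1))) holomorphic_on {w. Re w > - real (Suc N)}" if "j \<in> {2..M}" for j
      using that by (intro holomorphic_on_compose_gen[OF _ Z(1), unfolded o_def])
        (auto intro!: holomorphic_intros)
    moreover have "(\<lambda>w. beta_hurwitz 0 M a (w + of_nat (M + 1))) holomorphic_on {w. Re w > - real (Suc N)}"
      by (intro holomorphic_on_compose_gen[OF _ beta_hurwitz_holomorphic(1)[OF assms], unfolded o_def])
         (auto intro!: holomorphic_intros simp: M_def)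
    ultimately show ?thesis
      unfolding Z'_def pochhammer_prod using assms
      by (intro holomorphic_intros) auto
  qed
  ultimately show ?case by blast
qed

lemma hurwitz_series_continuation:
  assumes "Re a > 0"
  obtains f where "hurwitz_spec a f"
proof -
  obtain Z where Z: "\<And>N. Z N holomorphic_on {w. Re w > - real N}"
      "\<And>N w. Re w > 0 \<Longrightarrow> Z N w = w * hurwitz_series (w + 1) a"
    using hurwitz_series_continuation_halfplane[OF assms] by metis
  have Z_eq: "Z M w = Z N w" if "Re w > - real N" "Re w > - real M" for M N w
  proof (rule halfplane_identity[of "Z M" "- min (real N) (real M)" _ 0])
    show "Z M holomorphic_on {w. Re w > - min (real N) (real M)}"
         "Z N holomorphic_on {w. Re w > - min (real N) (real M)}"
      by (rule holomorphic_on_subset[OF Z(1)]; force)+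
  qed (use that Z(2) in auto)
  \<comment> \<open>An index N with N >= 2 - Re s puts s - 1 strictly inside the half-plane Re >
    -N.\<close>
  define f where "f = (\<lambda>s. Z (nat \<lceil>2 - Re s\<rceil>) (s - 1) / (s - 1))"
  have Re_bound: "Re (s - 1) > - real (nat \<lceil>2 - Re s\<rceil>)" for s :: complex
    by (simp add: le_nat_iff) linarith
  have "f holomorphic_on - {1}"
  proof -
    have "\<exists>g. (f has_field_derivative g) (at s)" if "s \<noteq> 1" for s
    proof -
      \<comment> \<open>The index is frozen at the one belonging to \<open>s\<close>. Nearby points
        may use another index in \<open>f\<close>, but \<open>Z_eq\<close> makes the values
        coincide.\<close>
      define N where "N = nat \<lceil>2 - Re s\<rceil>"
      define S where "S = {s. Re s > 1 - real N} - {1}"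
      have "open S"
        unfolding S_def by (intro open_delete open_halfspace_Re_gt)
      moreover have "s \<in> S"
        using that Re_bound[of s] by (simp add: S_def N_def)
      moreover have "(\<lambda>s. Z N (s - 1) / (s - 1)) holomorphic_on S"
        unfolding S_def
        by (intro holomorphic_intros holomorphic_on_compose_gen[OF _ Z(1), unfolded o_def]) auto
      hence "f holomorphic_on S"
        by (rule holomorphic_transform) (use Re_bound in \<open>auto simp: f_def S_def intro!: Z_eq\<close>)
      ultimately show ?thesis
        using holomorphic_on_open by blast
    qed
    thus ?thesis
      by (subst holomorphic_on_open) auto
  qed
  thus ?thesis
    by (intro that[of f]) (auto simp: f_def Z(2) hurwitz_spec_def)
qed

lemma hurwitz_zeta_spec:
  assumes "Re a > 0"
  shows "(\<lambda>s. hurwitz_zeta s a) holomorphic_on - {1}"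
    and "Re s > 1 \<Longrightarrow> hurwitz_zeta s a = hurwitz_series s a"
proof -
  have "hurwitz_spec a (SOME f. hurwitz_spec a f)"
    using hurwitz_series_continuation[OF assms] by (metis someI_ex)
  moreover have "(SOME f. hurwitz_spec a f) = (\<lambda>s. hurwitz_zeta s a)"
    by (simp add: hurwitz_zeta_def hurwitz_spec_def hurwitz_series_def fun_eq_iff)
  ultimately have "hurwitz_spec a (\<lambda>s. hurwitz_zeta s a)" by simp
  thus "(\<lambda>s. hurwitz_zeta s a) holomorphic_on - {1}"
    and "Re s > 1 \<Longrightarrow> hurwitz_zeta s a = hurwitz_series s a"
    by (auto simp: hurwitz_spec_def)
qed

lemma hurwitz_zeta_deriv_eq:
  assumes "Re a > 0" "Re s > 1"
  shows "hurwitz_zeta_deriv r s a = (deriv ^^ r) (\<lambda>s. hurwitz_series s a) s"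
  unfolding hurwitz_zeta_deriv_def
  using assms
  by (intro higher_deriv_transform_within_open[OF _ _ open_halfspace_Re_gt[of 1]]
      holomorphic_on_subset[OF hurwitz_zeta_spec(1)] holomorphic_on_hurwitz_series)
     (auto simp: hurwitz_zeta_spec)

text \<open>For Re w > 0 this is the recurrence divided by \<open>w\<close> and solved for its j = 1
  term. For Re w > -1 the arguments w + j with j >= 2 and w + m + n + 1 have real part > 1, so both
  sides are holomorphic off w = 0 and the identity theorem applies.\<close>

lemma hurwitz_zeta_recurrence:
  assumes "Re a > 0" "m + n \<ge> 1" "Re w > - 1" "w \<noteq> 0"
  shows "hurwitz_zeta (w + 1) a = a powr (- w) / w -
     (\<Sum>j=2..m + n. pochhammer (w + 1) (j - 1) *
        ((darboux_coeff m n j - (-1) ^ j * darboux_coeff n m j) * hurwitz_series (w + of_nat j) a))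
     + (\<Sum>j=1..m + n. pochhammer (w + 1) (j - 1) * (darboux_coeff m n j * a powr (- (w + of_nat j))))
     - (-1) ^ n / fact (m + n) * pochhammer (w + 1) (m + n) * beta_hurwitz m n a (w + of_nat (m + n + 1))"
    (is "?L w = ?R w")
proof -
  define c where "c = (\<lambda>j. darboux_coeff m n j - (-1) ^ j * darboux_coeff n m j)"
  define S where "S = {w. Re w > - 1} - {0 :: complex}"
  define U where "U = {w. Re w > 0}"
  have poch: "pochhammer w j = w * pochhammer (w + 1) (j - 1)" if "j \<ge> 1" for w :: complex and j
    using that by (cases j) (simp_all add: pochhammer_rec)
  have eq: "?L w - ?R w = 0" if "w \<in> U" for w
  proof -
    have w: "Re w > 0" "w \<noteq> 0"
      using that by (auto simp: U_def)
    have c1: "c 1 = 1"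
      using darboux_coeff_1[OF assms(2)] by (simp add: c_def)
    \<comment> \<open>The linear equation in abstract letters; \<open>w * p\<close> is the
      Pochhammer symbol of the remainder with its factor \<open>w\<close> split off.\<close>
    have solve: "A = w * H + w * X - w * Y + k * (w * p) * b \<Longrightarrow> H - (A / w - X + Y - k * p * b) = 0"
      for A H X Y k p b :: complex
      using w(2) by (simp add: field_simps)
    have "a powr (- w) = (\<Sum>j=1..m + n. pochhammer w j * (c j * hurwitz_series (w + of_nat j) a)) -
         (\<Sum>j=1..m + n. pochhammer w j * (darboux_coeff m n j * a powr (- (w + of_nat j))))
       + (-1) ^ n / fact (m + n) * pochhammer w (m + n + 1) * beta_hurwitz m n a (w + of_nat (m + n + 1))"
      using hurwitz_series_recurrence[OF assms(1) w(1), of m n]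
      by (simp only: c_def sum_subtractf right_diff_distrib)
    also have "(\<Sum>j=1..m + n. pochhammer w j * (c j * hurwitz_series (w + of_nat j) a)) =
        w * hurwitz_series (w + 1) a + (\<Sum>j=2..m + n. pochhammer w j * (c j * hurwitz_series (w + of_nat j) a))"
      using c1 assms(2) by (subst sum.atLeast_Suc_atMost) (auto simp: numeral_2_eq_2)
    also have "(\<Sum>j=2..m + n. pochhammer w j * (c j * hurwitz_series (w + of_nat j) a)) =
       w * (\<Sum>j=2..m + n. pochhammer (w + 1) (j - 1) * (c j * hurwitz_series (w + of_nat j) a))"
      unfolding sum_distrib_left by (intro sum.cong refl) (simp add: poch mult_ac)
    also have "(\<Sum>j=1..m + n. pochhammer w j * (darboux_coeff m n j * a powr (- (w + of_nat j)))) =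
       w * (\<Sum>j=1..m + n. pochhammer (w + 1) (j - 1) * (darboux_coeff m n j * a powr (- (w + of_nat j))))"
      unfolding sum_distrib_left by (intro sum.cong refl) (simp add: poch mult_ac)
    also have "pochhammer w (m + n + 1) = w * pochhammer (w + 1) (m + n)"
      by (simp add: poch)
    also have "hurwitz_series (w + 1) a = hurwitz_zeta (w + 1) a"
      using w assms(1) by (simp add: hurwitz_zeta_spec)
    finally show ?thesis
      unfolding c_def by (rule solve)
  qed
  have "?L holomorphic_on S"
    by (intro holomorphic_on_compose_gen[OF _ hurwitz_zeta_spec(1)[OF assms(1)], unfolded o_def])
       (auto intro!: holomorphic_intros simp: S_def)
  moreover have "?R holomorphic_on S"
  proof -
    have "(\<lambda>w. hurwitz_series (w + of_nat j) a) holomorphic_on S" if "j \<in> {2..m + n}" for j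
      using that by (intro holomorphic_on_compose_gen[OF _ holomorphic_on_hurwitz_series[OF assms(1)], unfolded o_def])
        (auto intro!: holomorphic_intros simp: S_def)
    moreover have "(\<lambda>w. beta_hurwitz m n a (w + of_nat (m + n + 1))) holomorphic_on S"
      using assms(2) by (intro holomorphic_on_compose_gen[OF _ beta_hurwitz_holomorphic(1)[OF assms(1)], unfolded o_def])
         (auto intro!: holomorphic_intros simp: S_def)
    ultimately show ?thesis
      unfolding pochhammer_prod using assms
      by (intro holomorphic_intros) (auto simp: S_def)
  qed
  ultimately have hol: "(\<lambda>w. ?L w - ?R w) holomorphic_on S"
    by (rule holomorphic_on_diff)
  have "open S"
    unfolding S_def by (intro open_delete open_halfspace_Re_gt)
  \<comment> \<open>Removing a point from an open connected set in the plane keeps it connected, so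
    the pole at w = 0 is no obstacle.\<close>
  have "connected S"
    unfolding S_def
    by (intro connected_open_delete open_halfspace_Re_gt convex_connected convex_halfspace_Re_gt) auto
  have "open U"
    unfolding U_def by (rule open_halfspace_Re_gt)
  hence "(1 :: complex) islimpt U"
    by (simp add: interior_limit_point interior_open U_def)
  hence "?L w - ?R w = 0"
    by (rule analytic_continuation[OF hol \<open>open S\<close> \<open>connected S\<close>, rotated 2])
       (use eq assms in \<open>auto simp: S_def U_def\<close>)
  thus ?thesis by simp
qed

subsection \<open>Laurent coefficients\<close>

text \<open>For j >= 1 the expansion at w = 0 of (w)_j / w; the division by \<open>w\<close>
  accounts for the index k + 1.\<close>

definition stirling_fps :: "nat \<Rightarrow> complex fps" where
  "stirling_fps j = Abs_fps (\<lambda>k. of_nat (stirling j (k + 1)))"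

text \<open>Off w = 0 the Stirling expansion of (w)_(n+1) is divided by \<open>w\<close>; at w = 0
  both sides are n!.\<close>

lemma pochhammer_shifted_stirling:
  fixes w :: complex
  shows "pochhammer (w + 1) n = (\<Sum>k\<le>n. of_nat (stirling (Suc n) (Suc k)) * w ^ k)"
proof (cases "w = 0")
  case True
  have "(\<Sum>k\<le>n. of_nat (stirling (Suc n) (Suc k)) * w ^ k) =
        (\<Sum>k\<in>{0}. of_nat (stirling (Suc n) (Suc k)) * w ^ k)"
    using True by (intro sum.mono_neutral_right) auto
  thus ?thesis
    using True by (simp add: stirling_Suc_n_1 del: stirling.simps flip: pochhammer_fact)
next
  case False
  have "w * pochhammer (w + 1) n = pochhammer w (Suc n)"
    by (simp add: pochhammer_rec)
  also have "\<dots> = (\<Sum>k\<le>Suc n. of_nat (stirling (Suc n) k) * w ^ k)"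
    by (rule stirling_pochhammer [symmetric])
  also have "\<dots> = w * (\<Sum>k\<le>n. of_nat (stirling (Suc n) (Suc k)) * w ^ k)"
    by (subst sum.atMost_Suc_shift) (simp add: sum_distrib_left mult_ac del: stirling.simps(4))
  finally show ?thesis
    using False by simp
qed

lemma has_fps_expansion_stirling_fps:
  assumes "j \<ge> 1"
  shows "(\<lambda>w. pochhammer (w + 1) (j - 1)) has_fps_expansion stirling_fps j"
proof -
  obtain n where n: "j = Suc n"
    using assms by (cases j) auto
  have "(\<lambda>w :: complex. \<Sum>k\<le>n. of_nat (stirling (Suc n) (Suc k)) * w ^ k) has_fps_expansion
          (\<Sum>k\<le>n. fps_const (of_nat (stirling (Suc n) (Suc k))) * fps_X ^ k)"
    by (intro has_fps_expansion_sum has_fps_expansion_mult has_fps_expansion_const has_fps_expansion_fps_X_power)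
  also have "(\<Sum>k\<le>n. fps_const (of_nat (stirling (Suc n) (Suc k))) * fps_X ^ k) = stirling_fps j"
    unfolding n
    by (rule fps_ext) (auto simp: fps_sum_nth stirling_fps_def fps_X_power_nth if_distrib
        mult_delta_right sum.delta' cong: if_cong simp del: stirling.simps(4))
  finally show ?thesis
    by (simp add: n pochhammer_shifted_stirling del: stirling.simps(4))
qed

text \<open>The Cauchy product, with (l - k)! inserted so that Taylor coefficients of
  \<open>F\<close> turn into derivatives. This is the source of the factor l!/(l - k)!.\<close>

lemma stirling_fps_mult_nth:
  "fact l * fps_nth (stirling_fps j * F) l =
     (\<Sum>k=0..l. of_nat (stirling j (k + 1)) * (fact l / fact (l - k)) * (fact (l - k) * fps_nth F (l - k)))"
  unfolding fps_mult_nth sum_distrib_left by (intro sum.cong refl) (simp add: stirling_fps_def)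

lemma stirling_fps_mult_expansion_nth:
  "fact l * fps_nth (stirling_fps j * fps_expansion f z) l =
     (\<Sum>k=0..l. of_nat (stirling j (k + 1)) * (fact l / fact (l - k)) * (deriv ^^ (l - k)) f z)"
  unfolding stirling_fps_mult_nth by (simp add: fps_expansion_def)

text \<open>Translates between unsigned and signed Stirling numbers: for k + 1 <= j the exponents j,
  j - k - 1 and k have an odd sum; otherwise both sides are 0.\<close>

lemma minus_one_power_signed_stirling:
  "(-1) ^ j * of_int (signed_stirling j (k + 1)) * (-1) ^ k = - (of_nat (stirling j (k + 1)) :: complex)"
proof (cases "k + 1 \<le> j")
  case True
  define i where "i = j - (k + 1)"
  have j: "j = i + k + 1"
    using True by (simp add: i_def)
  have sgn: "(-1) ^ j * ((-1) ^ i * c) * (-1) ^ k = - c" for c :: complex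
    by (simp add: j power_add mult_ac flip: power_mult_distrib)
  show ?thesis
    unfolding signed_stirling_def i_def[symmetric] of_int_mult of_int_power of_int_minus of_int_1
      of_int_of_nat_eq by (rule sgn)
next
  case False
  thus ?thesis
    by (simp add: signed_stirling_def)
qed

text \<open>\<open>hurwitz_zeta_recurrence\<close> expanded at w = 0. The quotient a^(-w)/w
  contributes the pole and the power of ln a; every other term is \<open>stirling_fps\<close> times
  a Taylor series.\<close>

lemma stieltjes_gamma_expansion:
  fixes a :: complex and l m n :: nat
  assumes "Re a > 0" "m + n \<ge> 1"
  shows "(-1) ^ l * stieltjes_gamma l a =
      (-1) ^ (l + 1) * (Ln a ^ (l + 1) / of_nat (l + 1))
    - (\<Sum>j=2..m + n. (darboux_coeff m n j - (-1) ^ j * darboux_coeff n m j) *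
        (\<Sum>k=0..l. of_nat (stirling j (k + 1)) * (fact l / fact (l - k)) *
           (deriv ^^ (l - k)) (\<lambda>s. hurwitz_series s a) (of_nat j)))
    + (\<Sum>j=1..m + n. darboux_coeff m n j * a powi (- int j) *
        (\<Sum>k=0..l. of_nat (stirling j (k + 1)) * (fact l / fact (l - k)) * (- Ln a) ^ (l - k)))
    - (-1) ^ n / fact (m + n) *
        (\<Sum>k=0..l. of_nat (stirling (m + n + 1) (k + 1)) * (fact l / fact (l - k)) *
           (deriv ^^ (l - k)) (beta_hurwitz m n a) (of_nat (m + n + 1)))"
proof -
  have "a \<noteq> 0"
    using assms(1) by auto
  define c where "c = (\<lambda>j. darboux_coeff m n j - (-1) ^ j * darboux_coeff n m j)"
  define Z where "Z = (\<lambda>j. fps_expansion (\<lambda>s. hurwitz_series s a) (of_nat j))"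
  define B where "B = fps_expansion (beta_hurwitz m n a) (of_nat (m + n + 1))"
  define G where "G = - (\<Sum>j=2..m + n. stirling_fps j * (fps_const (c j) * Z j))
     + (\<Sum>j=1..m + n. stirling_fps j * (fps_const (darboux_coeff m n j) * (fps_const (a powi (- int j)) * fps_exp (- Ln a))))
     - fps_const ((-1) ^ n / fact (m + n)) * stirling_fps (m + n + 1) * B"
  \<comment> \<open>The part of the recurrence analytic at w = 0, with expansion \<open>G\<close>;
    all series in it are centred at integers >= 2.\<close>
  define g where "g = (\<lambda>w. - (\<Sum>j=2..m + n. pochhammer (w + 1) (j - 1) *
        (c j * hurwitz_series (of_nat j + w) a))
     + (\<Sum>j=1..m + n. pochhammer (w + 1) (j - 1) * (darboux_coeff m n j * (a powi (- int j) * exp (- Ln a * w))))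
     - (-1) ^ n / fact (m + n) * pochhammer (w + 1) (m + n + 1 - 1) * beta_hurwitz m n a (of_nat (m + n + 1) + w))"
  have analytic: "f analytic_on {s}" if "f holomorphic_on {s. Re s > 1}" "Re s > 1" for f s
    using that open_halfspace_Re_gt[of 1] analytic_at by blast
  have "g has_fps_expansion G"
    unfolding g_def G_def Z_def B_def using assms
    by (intro fps_expansion_intros has_fps_expansion_stirling_fps analytic_at_imp_has_fps_expansion analytic
        holomorphic_on_hurwitz_series beta_hurwitz_holomorphic(1)) auto
  hence "(\<lambda>w. exp (- Ln a * w) * w powi (-1) + g w) has_laurent_expansion
           fls_shift 1 (fps_to_fls (fps_exp (- Ln a))) + fps_to_fls G"
    using has_laurent_expansion_shift'[OF has_laurent_expansion_fps[OF has_fps_expansion_exp[of "- Ln a"]], of 1]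
    by (intro has_laurent_expansion_add has_laurent_expansion_fps) auto
  also have "?this \<longleftrightarrow> (\<lambda>w. hurwitz_zeta (1 + w) a) has_laurent_expansion
           fls_shift 1 (fps_to_fls (fps_exp (- Ln a))) + fps_to_fls G"
  proof (intro has_laurent_expansion_cong refl)
    \<comment> \<open>The punctured unit disc guarantees both Re w > -1 and w nonzero, as the
      recurrence demands.\<close>
    have "eventually (\<lambda>w. w \<in> ball 0 1 - {0}) (at (0 :: complex))"
      by (intro eventually_at_in_open) auto
    thus "eventually (\<lambda>w. exp (- Ln a * w) * w powi (-1) + g w = hurwitz_zeta (1 + w) a) (at 0)"
    proof eventually_elim
      case (elim w)
      have powr: "a powr (- (w + of_nat j)) = a powi (- int j) * exp (- Ln a * w)" for j
      proof -
        have "a powr (- (w + of_nat j)) = a powr (- w - of_nat j)"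
          by simp
        also have "\<dots> = a powr (- w) / a powr of_nat j"
          by (rule powr_diff)
        also have "\<dots> = a powi (- int j) * exp (- Ln a * w)"
          using \<open>a \<noteq> 0\<close> by (simp add: powr_def[of a "- w"] power_int_minus divide_simps mult.commute)
        finally show ?thesis .
      qed
      have powr0: "a powr (- w) = exp (- Ln a * w)"
        using powr[of 0] by simp
      have "Re w > - 1"
        using elim abs_Re_le_cmod[of w] by auto
      from hurwitz_zeta_recurrence[OF assms this] elim
      show ?case
        unfolding powr powr0
        by (simp add: g_def c_def power_int_minus divide_inverse add_ac)
    qed
  qed
  finally have "laurent_expansion (\<lambda>s. hurwitz_zeta s a) 1 =
      fls_shift 1 (fps_to_fls (fps_exp (- Ln a))) + fps_to_fls G"
    by (rule laurent_expansion_eqI)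
  \<comment> \<open>Division by \<open>w\<close> moves the exponential's coefficient of index l + 1
    to index l.\<close>
  hence "fls_nth (laurent_expansion (\<lambda>s. hurwitz_zeta s a) 1) (int l) =
           (- Ln a) ^ (l + 1) / fact (l + 1) + fps_nth G l"
    by (simp add: nat_add_distrib algebra_simps)
  hence "(-1) ^ l * stieltjes_gamma l a = fact l * ((- Ln a) ^ (l + 1) / fact (l + 1) + fps_nth G l)"
    by (simp add: stieltjes_gamma_def flip: mult.assoc power_mult_distrib)
  also have "\<dots> = (-1) ^ (l + 1) * (Ln a ^ (l + 1) / of_nat (l + 1)) + fact l * fps_nth G l"
  proof -
    have "fact l * (x / fact (l + 1)) = x / of_nat (l + 1)" for x :: complex
      by (simp add: divide_simps del: of_nat_Suc)
    thus ?thesis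
      by (simp only: distrib_left power_minus[of "Ln a"] times_divide_eq_right)
  qed
  also have "fact l * fps_nth G l =
      - (\<Sum>j=2..m + n. c j * (fact l * fps_nth (stirling_fps j * Z j) l))
      + (\<Sum>j=1..m + n. darboux_coeff m n j * a powi (- int j) * (fact l * fps_nth (stirling_fps j * fps_exp (- Ln a)) l))
      - (-1) ^ n / fact (m + n) * (fact l * fps_nth (stirling_fps (m + n + 1) * B) l)"
  proof -
    have pull: "stirling_fps j * (fps_const x * F) = fps_const x * (stirling_fps j * F)" for j x F
      by (rule mult.left_commute)
    have "fps_nth G l =
      - (\<Sum>j=2..m + n. c j * fps_nth (stirling_fps j * Z j) l)
      + (\<Sum>j=1..m + n. darboux_coeff m n j * (a powi (- int j) * fps_nth (stirling_fps j * fps_exp (- Ln a)) l))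
      - (-1) ^ n / fact (m + n) * fps_nth (stirling_fps (m + n + 1) * B) l"
      unfolding G_def pull mult.assoc[of "fps_const ((-1) ^ n / fact (m + n))"]
      by (simp only: fps_add_nth fps_sub_nth fps_neg_nth fps_sum_nth fps_mult_left_const_nth)
    thus ?thesis
      by (simp add: sum_distrib_left distrib_left right_diff_distrib mult_ac)
  qed
  finally show ?thesis
    unfolding Z_def B_def stirling_fps_mult_expansion_nth c_def stirling_fps_mult_nth[of _ _ "fps_exp _"]
    by simp
qed

section \<open>Passage to signed Stirling numbers and the final summation ranges\<close>

theorem theorem2:
  fixes l m n :: nat and a :: complex
  assumes "m + n \<ge> 1" and "Re a > 0" and "norm a \<ge> 1"
  shows "(-1) ^ l * stieltjes_gamma l a =
      (\<Sum>j = 2..max m n.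
         (pochhammer (- of_nat m) j - (-1) ^ j * pochhammer (- of_nat n) j)
           / pochhammer (- of_nat n - of_nat m) j * ((-1) ^ j / fact j) *
         (\<Sum>k = 0..l. of_int (signed_stirling j (k + 1)) * (fact l / fact (l - k)) * (-1) ^ k *
            hurwitz_zeta_deriv (l - k) (of_nat j) a))
    + (\<Sum>k = 0..l. fact l / fact (l - k) * Ln a ^ (l - k) *
         (\<Sum>j = 1..m. pochhammer (- of_nat m) j / pochhammer (- of_nat n - of_nat m) j *
            ((-1) ^ (j + l + 1) * a powi (- int j) / fact j) * of_int (signed_stirling j (k + 1))))
    + (-1) ^ (l + 1) * (Ln a ^ (l + 1) / of_nat (l + 1))
    + (-1) ^ (m + 1) / fact (m + n) *
      (\<Sum>k = 0..l. of_int (signed_stirling (m + n + 1) (k + 1)) * (fact l / fact (l - k)) * (-1) ^ k *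
         integral {0..1} (\<lambda>x::real. of_real (x ^ m * (1 - x) ^ n) *
           hurwitz_zeta_deriv (l - k) (of_nat (m + n + 1)) (a + of_real x)))"
proof -
  let ?st = "\<lambda>j k. of_nat (stirling j (k + 1)) * (fact l / fact (l - k)) :: complex"
  have 1: "- (\<Sum>j=2..m + n. (darboux_coeff m n j - (-1) ^ j * darboux_coeff n m j) *
        (\<Sum>k=0..l. ?st j k * (deriv ^^ (l - k)) (\<lambda>s. hurwitz_series s a) (of_nat j))) =
     (\<Sum>j = 2..max m n.
         (pochhammer (- of_nat m) j - (-1) ^ j * pochhammer (- of_nat n) j)
           / pochhammer (- of_nat n - of_nat m) j * ((-1) ^ j / fact j) *
         (\<Sum>k = 0..l. of_int (signed_stirling j (k + 1)) * (fact l / fact (l - k)) * (-1) ^ k *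
            hurwitz_zeta_deriv (l - k) (of_nat j) a))" (is "- ?A = ?B")
  proof -
    \<comment> \<open>Beyond max(m, n) both Darboux coefficients vanish.\<close>
    have "?A = (\<Sum>j=2..max m n. (darboux_coeff m n j - (-1) ^ j * darboux_coeff n m j) *
        (\<Sum>k=0..l. ?st j k * (deriv ^^ (l - k)) (\<lambda>s. hurwitz_series s a) (of_nat j)))"
      by (rule sum.mono_neutral_right) (auto simp: darboux_coeff_eq_0)
    also have "\<dots> = - ?B"
      unfolding sum_negf[symmetric]
    proof (intro sum.cong refl)
      fix j assume j: "j \<in> {2..max m n}"
      have "(\<Sum>k=0..l. ?st j k * (deriv ^^ (l - k)) (\<lambda>s. hurwitz_series s a) (of_nat j)) =
            - ((-1) ^ j * (\<Sum>k = 0..l. of_int (signed_stirling j (k + 1)) * (fact l / fact (l - k)) * (-1) ^ k *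
                  hurwitz_zeta_deriv (l - k) (of_nat j) a))"
        unfolding sum_distrib_left sum_negf[symmetric]
      proof (intro sum.cong refl)
        fix k
        have st: "of_nat (stirling j (k + 1)) =
            - ((-1) ^ j * of_int (signed_stirling j (k + 1)) * (-1) ^ k :: complex)"
          by (simp only: minus_one_power_signed_stirling minus_minus)
        have "hurwitz_zeta_deriv (l - k) (of_nat j) a = (deriv ^^ (l - k)) (\<lambda>s. hurwitz_series s a) (of_nat j)"
          using assms j by (intro hurwitz_zeta_deriv_eq) auto
        thus "?st j k * (deriv ^^ (l - k)) (\<lambda>s. hurwitz_series s a) (of_nat j) =
          - ((-1) ^ j * (of_int (signed_stirling j (k + 1)) * (fact l / fact (l - k)) * (-1) ^ k *
                  hurwitz_zeta_deriv (l - k) (of_nat j) a))"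
          unfolding st by (simp only: mult_ac mult_minus_left mult_minus_right)
      qed
      moreover have "darboux_coeff m n j - (-1) ^ j * darboux_coeff n m j =
          (pochhammer (- of_nat m) j - (-1) ^ j * pochhammer (- of_nat n) j)
           / pochhammer (- of_nat n - of_nat m) j / fact j"
        by (simp add: darboux_coeff_def diff_divide_distrib minus_diff_commute)
      ultimately show "(darboux_coeff m n j - (-1) ^ j * darboux_coeff n m j) *
        (\<Sum>k=0..l. ?st j k * (deriv ^^ (l - k)) (\<lambda>s. hurwitz_series s a) (of_nat j)) =
        - ((pochhammer (- of_nat m) j - (-1) ^ j * pochhammer (- of_nat n) j)
           / pochhammer (- of_nat n - of_nat m) j * ((-1) ^ j / fact j) *
         (\<Sum>k = 0..l. of_int (signed_stirling j (k + 1)) * (fact l / fact (l - k)) * (-1) ^ k *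
            hurwitz_zeta_deriv (l - k) (of_nat j) a))"
        by (simp only: divide_inverse mult_ac mult_minus_left mult_minus_right)
    qed
    finally show ?thesis by simp
  qed
  have 2: "(\<Sum>j=1..m + n. darboux_coeff m n j * a powi (- int j) * (\<Sum>k=0..l. ?st j k * (- Ln a) ^ (l - k))) =
      (\<Sum>k = 0..l. fact l / fact (l - k) * Ln a ^ (l - k) *
         (\<Sum>j = 1..m. pochhammer (- of_nat m) j / pochhammer (- of_nat n - of_nat m) j *
            ((-1) ^ (j + l + 1) * a powi (- int j) / fact j) * of_int (signed_stirling j (k + 1))))"
    (is "?A = ?B")
  proof -
    \<comment> \<open>Only the coefficient with (-m)_j occurs here, so the range ends at m before
      the sums are exchanged.\<close>
    have "?A = (\<Sum>j=1..m. darboux_coeff m n j * a powi (- int j) * (\<Sum>k=0..l. ?st j k * (- Ln a) ^ (l - k)))"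
      by (rule sum.mono_neutral_right) (auto simp: darboux_coeff_eq_0)
    also have "\<dots> = (\<Sum>k=0..l. \<Sum>j=1..m. darboux_coeff m n j * a powi (- int j) * (?st j k * (- Ln a) ^ (l - k)))"
      unfolding sum_distrib_left by (rule sum.swap)
    also have "\<dots> = ?B"
      unfolding sum_distrib_left
    proof (intro sum.cong refl)
      fix k j assume "k \<in> {0..l}"
      have st: "of_nat (stirling j (k + 1)) =
            - ((-1) ^ j * of_int (signed_stirling j (k + 1)) * (-1) ^ k :: complex)"
        by (simp only: minus_one_power_signed_stirling minus_minus)
      \<comment> \<open>The sign of (-ln a)^(l-k) merges with (-1)^k from the Stirling number into
        (-1)^l.\<close>
      have "(-1 :: complex) ^ l = (-1) ^ k * (-1) ^ (l - k)"
        using \<open>k \<in> _\<close> by (simp flip: power_add)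
      hence sgn: "(-1 :: complex) ^ (j + l + 1) = - ((-1) ^ j * (-1) ^ k * (-1) ^ (l - k))"
        by (simp add: power_add)
      show "darboux_coeff m n j * a powi (- int j) * (?st j k * (- Ln a) ^ (l - k)) =
          fact l / fact (l - k) * Ln a ^ (l - k) * (pochhammer (- of_nat m) j / pochhammer (- of_nat n - of_nat m) j *
            ((-1) ^ (j + l + 1) * a powi (- int j) / fact j) * of_int (signed_stirling j (k + 1)))"
        unfolding st sgn darboux_coeff_def power_minus[of "Ln a"]
        by (simp only: divide_inverse mult_ac mult_minus_left mult_minus_right)
    qed
    finally show ?thesis .
  qed
  have 3: "- ((-1) ^ n / fact (m + n) *
        (\<Sum>k=0..l. ?st (m + n + 1) k * (deriv ^^ (l - k)) (beta_hurwitz m n a) (of_nat (m + n + 1)))) =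
      (-1) ^ (m + 1) / fact (m + n) *
      (\<Sum>k = 0..l. of_int (signed_stirling (m + n + 1) (k + 1)) * (fact l / fact (l - k)) * (-1) ^ k *
         integral {0..1} (\<lambda>x::real. of_real (x ^ m * (1 - x) ^ n) *
           hurwitz_zeta_deriv (l - k) (of_nat (m + n + 1)) (a + of_real x)))"
    unfolding sum_distrib_left sum_negf[symmetric]
  proof (intro sum.cong refl)
    fix k
    have st: "of_nat (stirling (m + n + 1) (k + 1)) =
            - ((-1) ^ (m + n + 1) * of_int (signed_stirling (m + n + 1) (k + 1)) * (-1) ^ k :: complex)"
      by (simp only: minus_one_power_signed_stirling minus_minus)
    \<comment> \<open>The two factors (-1)^n cancel, leaving (-1)^(m+1); the outer minus sign is
      absorbed by the one in \<open>st\<close>.\<close>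
    have sgn: "(-1) ^ n * ((-1) ^ (m + n + 1) * c) = ((-1) ^ (m + 1) * c :: complex)" for c
      by (simp add: power_add mult_ac flip: power_mult_distrib)
    have "(deriv ^^ (l - k)) (beta_hurwitz m n a) (of_nat (m + n + 1)) =
          integral {0..1} (\<lambda>x. of_real (x ^ m * (1 - x) ^ n) *
            (deriv ^^ (l - k)) (\<lambda>s. hurwitz_series s (a + of_real x)) (of_nat (m + n + 1)))"
      using assms by (intro beta_hurwitz_holomorphic(2)) auto
    also have "\<dots> = integral {0..1} (\<lambda>x. of_real (x ^ m * (1 - x) ^ n) *
           hurwitz_zeta_deriv (l - k) (of_nat (m + n + 1)) (a + of_real x))"
      using assms by (intro integral_cong) (simp add: hurwitz_zeta_deriv_eq)
    finally have I: "(deriv ^^ (l - k)) (beta_hurwitz m n a) (of_nat (m + n + 1)) = \<dots>" .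
    have gen: "- ((-1) ^ n / F * (- ((-1) ^ (m + n + 1) * s * e) * r * I)) = (-1) ^ (m + 1) / F * (s * r * e * I)"
      for F s e r I :: complex
      using sgn[of "s * e * r * I / F"] by (simp add: divide_inverse mult_ac)
    show "- ((-1) ^ n / fact (m + n) * (?st (m + n + 1) k *
             (deriv ^^ (l - k)) (beta_hurwitz m n a) (of_nat (m + n + 1)))) =
          (-1) ^ (m + 1) / fact (m + n) * (of_int (signed_stirling (m + n + 1) (k + 1)) * (fact l / fact (l - k)) * (-1) ^ k *
         integral {0..1} (\<lambda>x::real. of_real (x ^ m * (1 - x) ^ n) *
           hurwitz_zeta_deriv (l - k) (of_nat (m + n + 1)) (a + of_real x)))"
      unfolding st I by (rule gen)
  qed
  show ?thesis
    unfolding stieltjes_gamma_expansion[OF assms(2,1)] 1[symmetric] 2[symmetric] 3[symmetric]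
    by simp
qed

end
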